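(* Let $H$ be a real Hilbert space and let $T:H\to H$ be a nonexpansive operator with $Fix(T)=\{x\in H:Tx=x\}\neq\varnothing$. Let $z^{0},z^{-1}\in H$, let $\{e^k\}_{k\ge0}$ be a sequence in $H$, let $\{\alpha_k\},\{\lambda_k\}$ be real sequences, and define for $k\ge0$ $$\mu^{k}=z^{k}+\alpha_{k}(z^{k}-z^{k-1}),\qquad z^{k+1}=\mu^{k}+\lambda_{k}(T\mu^{k}+e^{k}-\mu^{k}).$$ Assume that one of the following two sets of hypotheses holds. Case 1: there are constants $\alpha\in[0,1)$ and $0<\lambda\le\lambda'<1$ with $0\le\alpha_k\le\alpha$ and $\lambda\le\lambda_k\le\lambda'$ for all $k$; $\sum_{k=0}^{+\infty}\alpha_k\|z^{k+1}-z^k\|^2<+\infty$; $\sum_{k=0}^{+\infty}\lambda_k\|e^k\|<+\infty$; and $\{z^k\}$ is bounded. In this case set $\theta=\lambda'$. Case 2: $\{\alpha_k\},\{\lambda_k\}$ are nondecreasing; there is $\alpha\in[0,1)$ with $0\le\alpha_k\le\alpha$ for all $k$ and $\alpha_0=0$; there are $\lambda,\sigma,\delta>0$ with $\delta>\frac{\alpha[\alpha(1+\alpha)+\sigma]}{1-\alpha^2}$ and $0<\lambda\le\lambda_k\le\frac{\delta-\alpha[\alpha(1+\alpha)+\alpha\delta+\sigma]}{\delta[1+\alpha(1+\alpha)+\alpha\delta+\sigma]}$ for all $k$; $\{z^k\}$ is bounded; and $\sum_{k=0}^{+\infty}\|e^k\|<+\infty$. In this case set $\theta=\frac{\delta-\alpha[\alpha(1+\alpha)+\alpha\delta+\sigma]}{\delta[1+\alpha(1+\alpha)+\alpha\delta+\sigma]}$.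 Then for every $z^*\in Fix(T)$ the quantity $$\Delta=\alpha\sum_{k=1}^{\infty}\big[\|z^k-z^*\|^2-\|z^{k-1}-z^*\|^2\big]_+ +\sum_{k=1}^{\infty}2\|z^{k+1}-z^*\|\,\lambda_k\|e^k\|+\sum_{k=1}^{\infty}\alpha_k(1+\alpha_k)\|z^k-z^{k-1}\|^2$$ is finite, where $[m]_+=\max\{m,0\}$, and for every $k\ge1$ $$\min_{1\le i\le k}\|T\mu^i-\mu^i\|^2\le\frac{1}{k\lambda(1-\theta)}\big(\|z^1-z^*\|^2+\Delta\big).$$ *)

theory Defs
  imports "HOL-Analysis.Analysis"
begin

definition nonexpansive :: "('a::real_normed_vector \<Rightarrow> 'a) \<Rightarrow> bool" where
  "nonexpansive T \<longleftrightarrow> (\<forall>x y. norm (T x - T y) \<le> norm (x - y))"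

definition Fix :: "('a \<Rightarrow> 'a) \<Rightarrow> 'a set" where
  "Fix T = {x. T x = x}"

definition pos_part :: "real \<Rightarrow> real" where
  "pos_part m = max m 0"

end

theory Submission
  imports Defs
begin

text \<open>
  Write \<open>s k = \<parallel>z\<^bsub>k+1\<^esub> - z\<^bsub>k\<^esub>\<parallel>\<close>, \<open>r k = \<parallel>T z\<^bsub>k\<^esub> - z\<^bsub>k\<^esub>\<parallel>\<close> and let \<open>p\<close> be a fixed point. Expanding the
  two convex combinations bounds \<open>\<parallel>z\<^bsub>k+1\<^esub> - p\<parallel>\<^sup>2 - \<parallel>z\<^bsub>k\<^esub> - p\<parallel>\<^sup>2\<close> by
  \<open>\<alpha>\<^sub>k (\<parallel>z\<^bsub>k\<^esub> - p\<parallel>\<^sup>2 - \<parallel>z\<^bsub>k-1\<^esub> - p\<parallel>\<^sup>2) + \<alpha>\<^sub>k (1 + \<alpha>\<^sub>k) s(k-1)\<^sup>2 - \<lambda>\<^sub>k (1 - \<lambda>\<^sub>k) \<parallel>T \<mu>\<^sub>k - \<mu>\<^sub>k\<parallel>\<^sup>2\<close>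
  plus an error term. Summing this gives the rate as soon as \<open>\<Sum> \<alpha>\<^sub>k s(k-1)\<^sup>2\<close> is finite.

  In case 2 the Lyapunov function \<open>\<parallel>z\<^bsub>k\<^esub> - p\<parallel>\<^sup>2 - \<alpha>\<^sub>k \<parallel>z\<^bsub>k-1\<^esub> - p\<parallel>\<^sup>2 + \<gamma>\<^sub>k s(k-1)\<^sup>2\<close> with
  \<open>\<gamma>\<^sub>k = \<alpha>\<^sub>k (1 + \<alpha>\<^sub>k) + \<alpha>\<^sub>k \<delta> (1 - \<lambda>\<^sub>k)\<close> decreases by \<open>\<sigma> s(k)\<^sup>2\<close>, up to errors.

  In case 1 the hypothesis controls \<open>\<Sum> \<alpha>\<^sub>k s(k)\<^sup>2\<close> instead, whose index is shifted by one. The shift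
  is overcome by the residual \<open>r\<close>. Up to errors, \<open>r(k+1)\<^sup>2 - r(k)\<^sup>2\<close> is at most a multiple of
  \<open>\<alpha>\<^sub>k s(k-1) s(k)\<close>, because \<open>z\<^bsub>k+1\<^esub>\<close> is close both to \<open>z\<^bsub>k\<^esub>\<close> and to the segment from \<open>\<mu>\<^sub>k\<close> to
  \<open>T \<mu>\<^sub>k\<close>. On the other hand, if \<open>s(k)\<close> and \<open>\<alpha>\<^bsub>k-1\<^esub> s(k-2)\<close> are small relative to \<open>s(k-1)\<close>, then
  nonexpansiveness of \<open>T\<close> between \<open>\<mu>\<^bsub>k-1\<^esub>\<close>, \<open>z\<^bsub>k\<^esub>\<close> and \<open>\<mu>\<^bsub>k\<^esub>\<close> forces \<open>r(k)\<^sup>2 \<le> (1 - c) r(k-1)\<^sup>2\<close>,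
  where \<open>c = (1 - \<theta>) (1 - \<alpha>)\<close>. Hence \<open>\<alpha>\<^sub>k s(k-1)\<^sup>2\<close> is dominated by a telescoping term, by the
  summable terms, and by small multiples of itself and of its predecessor.
\<close>

text \<open>Telescoping \<open>step\<close> bounds the partial sums of \<open>c\<close> by
  \<open>P 0 - B + suminf w\<close>. The lower bound \<open>B\<close> need not be nonnegative; the
  Lyapunov function of case 2 is only bounded below by minus a square.\<close>

lemma summable_of_descent:
  fixes P c w :: "nat \<Rightarrow> real"
  assumes c: "\<And>n. 0 \<le> c n" and w: "\<And>n. 0 \<le> w n" "summable w"
    and P: "\<And>n. B \<le> P n"
    and step: "\<And>n. P (Suc n) + c n \<le> P n + w n"
  shows "summable c"
proof (rule summableI_nonneg_bounded[of _ "P 0 - B + suminf w"])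
  fix n
  have "(\<Sum>i<n. c i) + P n \<le> P 0 + (\<Sum>i<n. w i)"
  proof (induction n)
    case (Suc n)
    then show ?case using step[of n] by simp
  qed simp
  moreover have "(\<Sum>i<n. w i) \<le> suminf w"
    using w by (intro sum_le_suminf) auto
  ultimately show "(\<Sum>i<n. c i) \<le> P 0 - B + suminf w"
    using P[of n] by linarith
qed (use c in auto)

section \<open>Squared norms of convex combinations, extrapolations and perturbations\<close>

lemma norm_convex_comb_sq:
  fixes x y :: "'a::real_inner"
  shows "(norm (x + t *\<^sub>R (y - x)))\<^sup>2
    = (1 - t) * (norm x)\<^sup>2 + t * (norm y)\<^sup>2 - t * (1 - t) * (norm (y - x))\<^sup>2"
  unfolding power2_norm_eq_inner
  by (simp add: inner_simps inner_commute algebra_simps power2_eq_square)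

text \<open>This is \<open>norm_convex_comb_sq\<close> with \<open>t\<close> replaced by
  \<open>- t\<close>.\<close>

lemma norm_extrapolation_sq:
  fixes x y :: "'a::real_inner"
  shows "(norm (x + t *\<^sub>R (x - y)))\<^sup>2
    = (1 + t) * (norm x)\<^sup>2 - t * (norm y)\<^sup>2 + t * (1 + t) * (norm (x - y))\<^sup>2"
  unfolding power2_norm_eq_inner
  by (simp add: inner_simps inner_commute algebra_simps power2_eq_square)

text \<open>The cross term carries \<open>norm (w + u)\<close> rather than \<open>norm w\<close>, so
  that each error gets multiplied by the distance of the new iterate to the fixed point, as in the
  error series of the theorem.\<close>

lemma norm_add_sq_le:
  fixes w u :: "'a::real_inner"
  shows "(norm (w + u))\<^sup>2 \<le> (norm w)\<^sup>2 + 2 * norm (w + u) * norm u"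
proof -
  have "(norm (w + u))\<^sup>2 = (norm w)\<^sup>2 + 2 * inner (w + u) u - (norm u)\<^sup>2"
    unfolding power2_norm_eq_inner by (simp add: inner_simps inner_commute)
  moreover have "inner (w + u) u \<le> norm (w + u) * norm u"
    by (rule norm_cauchy_schwarz)
  moreover have "0 \<le> (norm u)\<^sup>2" by simp
  ultimately show ?thesis by linarith
qed

section \<open>The iteration shared by both cases, and its uniform bounds\<close>

locale inertial_iteration =
  fixes T :: "'a::real_inner \<Rightarrow> 'a"
    and z mu e :: "nat \<Rightarrow> 'a"
    and a l :: "nat \<Rightarrow> real"
    and alpha lam theta :: real
  assumes T: "nonexpansive T"
    and Fix_ne: "Fix T \<noteq> {}"
    and mu_Suc: "mu (Suc n) = z (Suc n) + a (Suc n) *\<^sub>R (z (Suc n) - z n)"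
    and z_Suc: "z (Suc n) = mu n + l n *\<^sub>R (T (mu n) + e n - mu n)"
    and a_nonneg: "0 \<le> a n" and a_le: "a n \<le> alpha" and alpha_less: "alpha < 1"
    and lam_pos: "0 < lam" and l_ge: "lam \<le> l n" and l_le: "l n \<le> theta"
    and theta_less: "theta < 1"
    and bounded_z: "bounded (range z)"
    and summable_e: "summable (\<lambda>n. norm (e n))"
begin

definition s :: "nat \<Rightarrow> real" where "s n = norm (z (Suc n) - z n)"

definition r :: "nat \<Rightarrow> real" where "r n = norm (T (z n) - z n)"

definition g :: "nat \<Rightarrow> 'a" where "g n = T (mu n) - mu n"

lemma T_le: "norm (T x - T y) \<le> norm (x - y)"
  using T by (simp add: nonexpansive_def)

lemma s_nonneg: "0 \<le> s n" and r_nonneg: "0 \<le> r n"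
  by (simp_all add: s_def r_def)

lemma l_pos: "0 < l n" using lam_pos l_ge[of n] by linarith

lemma l_less: "l n < 1" using theta_less l_le[of n] by linarith

lemma a_less: "a n < 1" using alpha_less a_le[of n] by linarith

lemma alpha_nonneg: "0 \<le> alpha" using a_nonneg[of 0] a_le[of 0] by linarith

lemma lam_less: "lam < 1" using l_ge[of 0] l_less[of 0] by linarith

lemma z_Suc': "z (Suc n) = mu n + l n *\<^sub>R (g n + e n)"
  using z_Suc[of n] by (simp add: g_def algebra_simps)

lemma increment:
  "z (Suc (Suc n)) - z (Suc n) = a (Suc n) *\<^sub>R (z (Suc n) - z n) + l (Suc n) *\<^sub>R (g (Suc n) + e (Suc n))"
  by (simp add: z_Suc'[of "Suc n"] mu_Suc)

text \<open>A single \<open>M\<close> allows any product of an error norm with a bounded quantity to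
  be replaced by a multiple of the error norm, which is summable. The residual is bounded because
  \<open>r n\<close> is at most twice the distance of \<open>z n\<close> to a fixed point.\<close>

lemma ex_bound:
  obtains M where "1 \<le> M" "\<And>n. s n \<le> M" "\<And>n. r n \<le> M" "\<And>n. norm (e n) \<le> M"
proof -
  obtain B where B: "\<And>n. norm (z n) \<le> B"
    using bounded_z by (auto simp: bounded_iff)
  obtain p where p: "T p = p" using Fix_ne by (auto simp: Fix_def)
  have "norm (e n) \<le> suminf (\<lambda>n. norm (e n))" for n
    using sum_le_suminf[OF summable_e, of "{n}"] by simp
  moreover have "s n \<le> 2 * B" for n
    using norm_triangle_ineq4[of "z (Suc n)" "z n"] B[of n] B[of "Suc n"] by (simp add: s_def)
  moreover have "r n \<le> 2 * B + 2 * norm p" for n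
  proof -
    have "norm (T (z n) - z n) \<le> norm (T (z n) - T p) + norm (z n - p)"
      using norm_triangle_ineq4[of "T (z n) - T p" "z n - p"] by (simp add: p)
    also have "\<dots> \<le> 2 * norm (z n - p)" using T_le[of "z n" p] by simp
    also have "\<dots> \<le> 2 * (B + norm p)" using norm_triangle_ineq4[of "z n" p] B[of n] by simp
    finally show ?thesis by (simp add: r_def)
  qed
  ultimately show thesis
    by (intro that[of "max 1 (max (suminf (\<lambda>n. norm (e n))) (max (2 * B) (2 * B + 2 * norm p)))"])
      (auto simp: le_max_iff_disj simp del: max.absorb1 max.absorb2 max.absorb3 max.absorb4)
qed

subsection \<open>The rate of the residual\<close>

text \<open>Up to the error, the new iterate is a convex combination of \<open>mu\<close> and
  \<open>T mu\<close>. The convexity identity produces the residual term, nonexpansiveness towards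
  the fixed point removes \<open>T\<close>, and the extrapolation identity expands
  \<open>mu\<close>.\<close>

lemma fundamental_inequality:
  assumes "p \<in> Fix T"
  shows "(norm (z (Suc (Suc n)) - p))\<^sup>2
    \<le> (1 + a (Suc n)) * (norm (z (Suc n) - p))\<^sup>2 - a (Suc n) * (norm (z n - p))\<^sup>2
      + a (Suc n) * (1 + a (Suc n)) * (s n)\<^sup>2
      - l (Suc n) * (1 - l (Suc n)) * (norm (g (Suc n)))\<^sup>2
      + 2 * norm (z (Suc (Suc n)) - p) * l (Suc n) * norm (e (Suc n))"
proof -
  define k where "k = Suc n"
  have p: "T p = p" using assms by (simp add: Fix_def)
  define w where "w = (mu k - p) + l k *\<^sub>R ((T (mu k) - p) - (mu k - p))"
  have zw: "z (Suc k) - p = w + l k *\<^sub>R e k"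
    by (simp add: w_def z_Suc algebra_simps)
  have "(norm (z (Suc k) - p))\<^sup>2 \<le> (norm w)\<^sup>2 + 2 * norm (z (Suc k) - p) * l k * norm (e k)"
    using norm_add_sq_le[of w "l k *\<^sub>R e k"] l_pos[of k] by (simp add: zw mult.assoc)
  moreover have "(norm w)\<^sup>2 = (1 - l k) * (norm (mu k - p))\<^sup>2 + l k * (norm (T (mu k) - p))\<^sup>2
      - l k * (1 - l k) * (norm (g k))\<^sup>2"
    unfolding w_def norm_convex_comb_sq by (simp add: g_def)
  moreover have "(norm (T (mu k) - p))\<^sup>2 \<le> (norm (mu k - p))\<^sup>2"
    using T_le[of "mu k" p] by (simp add: p power_mono)
  then have "l k * (norm (T (mu k) - p))\<^sup>2 \<le> l k * (norm (mu k - p))\<^sup>2"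
    using l_pos[of k] by simp
  moreover have "(norm (mu k - p))\<^sup>2 = (1 + a k) * (norm (z k - p))\<^sup>2 - a k * (norm (z n - p))\<^sup>2
      + a k * (1 + a k) * (s n)\<^sup>2"
    using norm_extrapolation_sq[of "z k - p" "a k" "z n - p"]
    by (simp add: s_def mu_Suc k_def algebra_simps)
  ultimately show ?thesis unfolding k_def by (simp add: algebra_simps)
qed

lemma summable_error_term:
  "summable (\<lambda>k. 2 * norm (z (Suc k + 1) - p) * l (Suc k) * norm (e (Suc k)))"
proof -
  obtain B where B: "\<And>n. norm (z n) \<le> B"
    using bounded_z by (auto simp: bounded_iff)
  have "norm (2 * norm (z (Suc k + 1) - p) * l (Suc k) * norm (e (Suc k)))
      \<le> 2 * (B + norm p) * norm (e (Suc k))" for k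
  proof -
    have "norm (z (Suc k + 1) - p) \<le> B + norm p"
      using norm_triangle_ineq4[of "z (Suc k + 1)" p] B[of "Suc k + 1"] by simp
    then have "norm (z (Suc k + 1) - p) * l (Suc k) \<le> (B + norm p) * 1"
      using l_pos[of "Suc k"] l_less[of "Suc k"] by (intro mult_mono) (auto intro: order_trans[OF norm_ge_zero])
    then show ?thesis using l_pos[of "Suc k"]
      by (simp add: abs_mult mult_right_mono)
  qed
  moreover have "summable (\<lambda>k. 2 * (B + norm p) * norm (e (Suc k)))"
    using summable_e summable_Suc_iff[of "\<lambda>n. norm (e n)"] by (intro summable_mult) simp
  ultimately show ?thesis by (rule summable_comparison_test'[rotated])
qed

lemma summable_inertial_term:
  assumes "summable (\<lambda>n. a (Suc n) * (s n)\<^sup>2)"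
  shows "summable (\<lambda>n. a (Suc n) * (1 + a (Suc n)) * (s n)\<^sup>2)"
proof (rule summable_comparison_test'[where N = 0])
  show "summable (\<lambda>n. 2 * (a (Suc n) * (s n)\<^sup>2))" using assms by (rule summable_mult)
  show "norm (a (Suc n) * (1 + a (Suc n)) * (s n)\<^sup>2) \<le> 2 * (a (Suc n) * (s n)\<^sup>2)" for n
  proof -
    have "(1 + a (Suc n)) * (a (Suc n) * (s n)\<^sup>2) \<le> 2 * (a (Suc n) * (s n)\<^sup>2)"
      using a_nonneg[of "Suc n"] a_less[of "Suc n"] by (intro mult_right_mono) auto
    then show ?thesis using a_nonneg[of "Suc n"] by (simp add: mult_ac abs_mult)
  qed
qed

text \<open>The fundamental inequality gives \<open>t (Suc k) \<le> alpha * t k + w k\<close>. As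
  \<open>alpha < 1\<close>, this is a descent of \<open>t\<close> itself by
  \<open>(1 - alpha) * t k\<close>.\<close>

lemma summable_pos_part:
  assumes "summable (\<lambda>n. a (Suc n) * (s n)\<^sup>2)" and p: "p \<in> Fix T"
  shows "summable (\<lambda>k. pos_part ((norm (z (Suc k) - p))\<^sup>2 - (norm (z k - p))\<^sup>2))"
proof -
  define t where "t k = pos_part ((norm (z (Suc k) - p))\<^sup>2 - (norm (z k - p))\<^sup>2)" for k
  define w where "w k = 2 * norm (z (Suc k + 1) - p) * l (Suc k) * norm (e (Suc k))
    + a (Suc k) * (1 + a (Suc k)) * (s k)\<^sup>2" for k
  have t0: "0 \<le> t k" for k by (simp add: t_def pos_part_def)
  have w0: "0 \<le> w k" for k using l_pos[of "Suc k"] a_nonneg[of "Suc k"] by (simp add: w_def)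
  have w: "summable w" unfolding w_def
    by (intro summable_add summable_error_term summable_inertial_term assms)
  have step: "t (Suc k) \<le> alpha * t k + w k" for k
  proof -
    have "a (Suc k) * ((norm (z (Suc k) - p))\<^sup>2 - (norm (z k - p))\<^sup>2) \<le> a (Suc k) * t k"
      using a_nonneg[of "Suc k"] by (intro mult_left_mono) (auto simp: t_def pos_part_def)
    moreover have "a (Suc k) * t k \<le> alpha * t k" using a_le t0 by (intro mult_right_mono) auto
    moreover have "0 \<le> l (Suc k) * (1 - l (Suc k)) * (norm (g (Suc k)))\<^sup>2"
      using l_pos[of "Suc k"] l_less[of "Suc k"] by simp
    ultimately have "(norm (z (Suc (Suc k)) - p))\<^sup>2 - (norm (z (Suc k) - p))\<^sup>2 \<le> alpha * t k + w k"
      using fundamental_inequality[OF p, of k] by (simp add: w_def algebra_simps)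
    then show ?thesis using t0[of k] w0[of k] alpha_nonneg by (simp add: t_def[of "Suc k"] pos_part_def)
  qed
  have "summable (\<lambda>k. (1 - alpha) * t k)"
  proof (rule summable_of_descent[where P = t and w = w and B = 0])
    show "t (Suc n) + (1 - alpha) * t n \<le> t n + w n" for n
      using step[of n] by (simp add: left_diff_distrib)
  qed (use t0 w0 w alpha_less in auto)
  then show ?thesis using alpha_less by (simp add: summable_cmult_iff t_def)
qed

text \<open>The fundamental inequality is summed over the indices 1 to \<open>k\<close>, with every
  squared residual bounded below by the minimum \<open>m\<close> and \<open>l * (1 - l)\<close>
  bounded below by \<open>lam * (1 - theta)\<close>.\<close>

lemma residual_bound:
  assumes sm: "summable (\<lambda>n. a (Suc n) * (s n)\<^sup>2)" and p: "p \<in> Fix T" and "1 \<le> k"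
  shows "Min ((\<lambda>i. (norm (T (mu i) - mu i))\<^sup>2) ` {1..k})
    \<le> 1 / (real k * lam * (1 - theta)) * ((norm (z 1 - p))\<^sup>2
      + (alpha * (\<Sum>k. pos_part ((norm (z (Suc k) - p))\<^sup>2 - (norm (z k - p))\<^sup>2))
        + (\<Sum>k. 2 * norm (z (Suc k + 1) - p) * l (Suc k) * norm (e (Suc k)))
        + (\<Sum>k. a (Suc k) * (1 + a (Suc k)) * (s k)\<^sup>2)))"
proof -
  define t where "t k = pos_part ((norm (z (Suc k) - p))\<^sup>2 - (norm (z k - p))\<^sup>2)" for k
  define u where "u k = 2 * norm (z (Suc k + 1) - p) * l (Suc k) * norm (e (Suc k))" for k
  define v where "v k = a (Suc k) * (1 + a (Suc k)) * (s k)\<^sup>2" for k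
  define m where "m = Min ((\<lambda>i. (norm (T (mu i) - mu i))\<^sup>2) ` {1..k})"
  have c: "0 < lam * (1 - theta)" using lam_pos theta_less by simp
  have nonneg: "0 \<le> t n" "0 \<le> u n" "0 \<le> v n" for n
    using l_pos[of "Suc n"] a_nonneg[of "Suc n"] by (auto simp: t_def u_def v_def pos_part_def)
  have summ: "summable t" "summable u" "summable v"
    unfolding t_def u_def v_def
    by (intro summable_error_term summable_inertial_term summable_pos_part sm p)+
  have step: "(norm (z (Suc (Suc n)) - p))\<^sup>2 + lam * (1 - theta) * m
      \<le> (norm (z (Suc n) - p))\<^sup>2 + alpha * t n + u n + v n" if "n < k" for n
  proof -
    have "a (Suc n) * ((norm (z (Suc n) - p))\<^sup>2 - (norm (z n - p))\<^sup>2) \<le> a (Suc n) * t n"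
      using a_nonneg[of "Suc n"] by (intro mult_left_mono) (auto simp: t_def pos_part_def)
    also have "\<dots> \<le> alpha * t n" using a_le nonneg by (intro mult_right_mono) auto
    finally have 1: "a (Suc n) * ((norm (z (Suc n) - p))\<^sup>2 - (norm (z n - p))\<^sup>2) \<le> alpha * t n" .
    have "m \<le> (norm (g (Suc n)))\<^sup>2"
      unfolding m_def g_def using that by (intro Min_le) auto
    then have "lam * (1 - theta) * m \<le> lam * (1 - theta) * (norm (g (Suc n)))\<^sup>2"
      using c by (intro mult_left_mono) auto
    also have "\<dots> \<le> l (Suc n) * (1 - l (Suc n)) * (norm (g (Suc n)))\<^sup>2"
      using lam_pos l_ge[of "Suc n"] l_le[of "Suc n"] theta_less
      by (intro mult_right_mono mult_mono) auto
    finally show ?thesis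
      using fundamental_inequality[OF p, of n] 1 by (simp add: u_def v_def algebra_simps)
  qed
  have "(norm (z (Suc n) - p))\<^sup>2 + real n * (lam * (1 - theta) * m)
      \<le> (norm (z 1 - p))\<^sup>2 + (alpha * (\<Sum>i<n. t i) + (\<Sum>i<n. u i) + (\<Sum>i<n. v i))" if "n \<le> k" for n
    using that
  proof (induction n)
    case (Suc n)
    then show ?case using step[of n] by (simp add: algebra_simps)
  qed simp
  from this[of k] have "real k * (lam * (1 - theta) * m)
      \<le> (norm (z 1 - p))\<^sup>2 + (alpha * (\<Sum>i<k. t i) + (\<Sum>i<k. u i) + (\<Sum>i<k. v i))"
    using zero_le_power2[of "norm (z (Suc k) - p)"] by linarith
  also have "\<dots> \<le> (norm (z 1 - p))\<^sup>2 + (alpha * suminf t + suminf u + suminf v)"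
    using summ nonneg alpha_nonneg
    by (intro add_mono mult_left_mono sum_le_suminf) auto
  finally have "m \<le> ((norm (z 1 - p))\<^sup>2 + (alpha * suminf t + suminf u + suminf v)) / (real k * (lam * (1 - theta)))"
    using mult_pos_pos[OF _ c, of "real k"] \<open>1 \<le> k\<close>
    by (simp add: pos_le_divide_eq mult_ac del: mult_pos_pos zero_less_mult_iff)
  then show ?thesis by (simp add: m_def t_def[abs_def] u_def[abs_def] v_def[abs_def] mult.assoc)
qed

subsection \<open>Case 1: growth and contraction of the residual\<close>

text \<open>Both \<open>T\<close> and the identity are 1-Lipschitz, so their difference is
  2-Lipschitz. This transfers residuals between \<open>z\<close> and \<open>mu\<close>.\<close>

lemma residual_lipschitz: "norm (T x - x) \<le> norm (T y - y) + 2 * norm (x - y)"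
proof -
  have "norm (T x - x) \<le> norm (T x - T y) + norm (T y - y) + norm (x - y)"
    using norm_triangle_ineq4[of "(T x - T y) + (T y - y)" "x - y"]
      norm_triangle_ineq[of "T x - T y" "T y - y"] by (simp add: algebra_simps)
  then show ?thesis using T_le[of x y] by simp
qed

lemma norm_mu_diff: "norm (mu (Suc n) - z (Suc n)) = a (Suc n) * s n"
  using a_nonneg[of "Suc n"] by (simp add: mu_Suc s_def)

lemma g_le: "norm (g (Suc n)) \<le> r (Suc n) + 2 * (a (Suc n) * s n)"
  using residual_lipschitz[of "mu (Suc n)" "z (Suc n)"] norm_mu_diff[of n] by (simp add: g_def r_def)

lemma r_le_g: "r (Suc n) \<le> norm (g (Suc n)) + 2 * (a (Suc n) * s n)"
  using residual_lipschitz[of "z (Suc n)" "mu (Suc n)"] norm_mu_diff[of n]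
  by (simp add: g_def r_def norm_minus_commute)

lemma r_Suc_le_s: "r (Suc n) \<le> r n + 2 * s n"
  using residual_lipschitz[of "z (Suc n)" "z n"] by (simp add: r_def s_def)

text \<open>Without error, \<open>z (Suc n)\<close> lies on the segment from \<open>mu n\<close> to
  \<open>T (mu n)\<close>. Its distances to the two ends are \<open>l n\<close> and
  \<open>1 - l n\<close> times \<open>norm (g n)\<close>, and they add up to
  \<open>norm (g n)\<close> without loss.\<close>

lemma r_Suc_le_g: "r (Suc n) \<le> norm (g n) + 2 * norm (e n)"
proof -
  have "r (Suc n) \<le> norm (T (z (Suc n)) - T (mu n)) + norm (T (mu n) - z (Suc n))"
    unfolding r_def using norm_triangle_ineq[of "T (z (Suc n)) - T (mu n)" "T (mu n) - z (Suc n)"] by simp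
  also have "\<dots> \<le> norm (l n *\<^sub>R (g n + e n)) + norm ((1 - l n) *\<^sub>R g n - l n *\<^sub>R e n)"
  proof (rule add_mono)
    show "norm (T (z (Suc n)) - T (mu n)) \<le> norm (l n *\<^sub>R (g n + e n))"
      using T_le[of "z (Suc n)" "mu n"] by (simp add: z_Suc')
    have "T (mu n) - z (Suc n) = (1 - l n) *\<^sub>R g n - l n *\<^sub>R e n"
      by (simp add: z_Suc g_def algebra_simps)
    then show "norm (T (mu n) - z (Suc n)) \<le> norm ((1 - l n) *\<^sub>R g n - l n *\<^sub>R e n)" by simp
  qed
  also have "\<dots> \<le> l n * (norm (g n) + norm (e n)) + ((1 - l n) * norm (g n) + l n * norm (e n))"
    using norm_triangle_ineq[of "g n" "e n"] norm_triangle_ineq4[of "(1 - l n) *\<^sub>R g n" "l n *\<^sub>R e n"]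
      l_pos[of n] l_less[of n] by (intro add_mono) auto
  also have "\<dots> = norm (g n) + 2 * l n * norm (e n)" by (simp add: algebra_simps)
  also have "\<dots> \<le> norm (g n) + 2 * norm (e n)"
    using l_less[of n] l_pos[of n] mult_left_le_one_le[of "norm (e n)" "l n"] by simp
  finally show ?thesis .
qed

lemma s_le: "s (Suc n) \<le> r (Suc n) + 3 * (a (Suc n) * s n) + norm (e (Suc n))"
proof -
  have "s (Suc n) \<le> a (Suc n) * s n + l (Suc n) * norm (g (Suc n) + e (Suc n))"
    unfolding s_def increment using a_nonneg[of "Suc n"] l_pos[of "Suc n"]
    by (intro order_trans[OF norm_triangle_ineq]) simp
  also have "l (Suc n) * norm (g (Suc n) + e (Suc n)) \<le> 1 * (norm (g (Suc n)) + norm (e (Suc n)))"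
    using l_pos[of "Suc n"] l_less[of "Suc n"] by (intro mult_mono norm_triangle_ineq) auto
  finally show ?thesis using g_le[of n] by simp
qed

text \<open>A converse to \<open>s_le\<close>: solving the increment formula for \<open>g\<close>
  and dividing by \<open>l \<ge> lam\<close> bounds the residual by increments.\<close>

lemma r_le_s: "r (Suc n) \<le> 3 / lam * (s (Suc n) + a (Suc n) * s n) + norm (e (Suc n))"
proof -
  define Q where "Q = a (Suc n) * s n"
  have Q0: "0 \<le> Q" using a_nonneg[of "Suc n"] s_nonneg by (simp add: Q_def)
  have "l (Suc n) *\<^sub>R (g (Suc n) + e (Suc n))
      = (z (Suc (Suc n)) - z (Suc n)) - a (Suc n) *\<^sub>R (z (Suc n) - z n)"
    by (simp add: increment)
  then have "norm (l (Suc n) *\<^sub>R (g (Suc n) + e (Suc n))) \<le> s (Suc n) + Q"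
    using norm_triangle_ineq4[of "z (Suc (Suc n)) - z (Suc n)" "a (Suc n) *\<^sub>R (z (Suc n) - z n)"]
      a_nonneg[of "Suc n"] by (simp add: s_def Q_def)
  moreover have "lam * norm (g (Suc n) + e (Suc n)) \<le> norm (l (Suc n) *\<^sub>R (g (Suc n) + e (Suc n)))"
    using l_pos[of "Suc n"] l_ge[of "Suc n"] by (simp add: mult_right_mono)
  ultimately have "norm (g (Suc n) + e (Suc n)) \<le> (s (Suc n) + Q) / lam"
    using lam_pos by (simp add: pos_le_divide_eq mult.commute)
  moreover have "norm (g (Suc n)) \<le> norm (g (Suc n) + e (Suc n)) + norm (e (Suc n))"
    using norm_triangle_ineq4[of "g (Suc n) + e (Suc n)" "e (Suc n)"] by simp
  moreover have "Q \<le> (s (Suc n) + Q) / lam"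
  proof -
    have "Q * lam \<le> Q" using Q0 lam_less lam_pos by (simp add: mult_left_le)
    then show ?thesis using lam_pos s_nonneg[of "Suc n"] by (simp add: pos_le_divide_eq)
  qed
  ultimately have "r (Suc n) \<le> 3 * ((s (Suc n) + Q) / lam) + norm (e (Suc n))"
    using r_le_g[of n] unfolding Q_def by linarith
  then show ?thesis by (simp add: Q_def)
qed

text \<open>Up to errors the residual grows by at most \<open>2 * S\<close>, by the Lipschitz bound,
  and also by at most \<open>2 * A\<close>, through \<open>g\<close>. Hence it grows by at most
  twice the minimum \<open>m\<close>, and squaring turns this minimum into the product
  \<open>A * S\<close>.\<close>

lemma residual_growth:
  obtains C where "0 \<le> C"
    "\<And>n. (r (Suc (Suc n)))\<^sup>2 \<le> (r (Suc n))\<^sup>2 + C * (a (Suc n) * s n * s (Suc n) + norm (e (Suc n)))"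
proof -
  obtain M where M: "1 \<le> M" "\<And>n. s n \<le> M" "\<And>n. r n \<le> M" "\<And>n. norm (e n) \<le> M"
    by (rule ex_bound) blast
  define C where "C = 4 + 24 / lam + 20 * M"
  have "(r (Suc (Suc n)))\<^sup>2 \<le> (r (Suc n))\<^sup>2 + C * (a (Suc n) * s n * s (Suc n) + norm (e (Suc n)))" for n
  proof -
    define A where "A = a (Suc n) * s n"
    define S where "S = s (Suc n)"
    define E where "E = norm (e (Suc n))"
    define R where "R = r (Suc n)"
    define m where "m = min S A"
    have nn: "0 \<le> A" "0 \<le> S" "0 \<le> E" "0 \<le> R"
      using a_nonneg[of "Suc n"] s_nonneg r_nonneg by (auto simp: A_def S_def E_def R_def)
    have m0: "0 \<le> m" and mS: "m \<le> S" and mA: "m \<le> A" using nn by (auto simp: m_def)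
    have bd: "S \<le> M" "E \<le> M" "R \<le> M" using M by (auto simp: S_def E_def R_def)
    have "r (Suc (Suc n)) \<le> R + 2 * m + 2 * E"
      using r_Suc_le_s[of "Suc n"] r_Suc_le_g[of "Suc n"] g_le[of n] nn(3)
      unfolding m_def S_def A_def E_def R_def by linarith
    then have "(r (Suc (Suc n)))\<^sup>2 \<le> (R + 2 * m + 2 * E)\<^sup>2"
      using r_nonneg by (intro power_mono)
    also have "\<dots> = R\<^sup>2 + 4 * (m * m) + 4 * (m * R) + (4 * (E * E) + 4 * (R * E) + 8 * (m * E))"
      by (simp add: power2_eq_square algebra_simps)
    also have "\<dots> \<le> R\<^sup>2 + 4 * (A * S) + 4 * (6 / lam * (A * S) + M * E) + (4 * (M * E) + 4 * (M * E) + 8 * (M * E))"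
    proof (intro add_mono mult_left_mono order_refl)
      show "m * m \<le> A * S" using m0 mA mS nn by (intro mult_mono) auto
      show "E * E \<le> M * E" "R * E \<le> M * E" "m * E \<le> M * E"
        using bd nn mS by (auto intro!: mult_right_mono)
      \<comment> \<open>By \<open>r_le_s\<close> the factor \<open>R\<close> is itself of order
        \<open>S + A\<close>, and \<open>m\<close> times either summand is at most
        \<open>A * S\<close>.\<close>
      have "m * R \<le> m * (3 / lam * (S + A) + E)"
        using m0 r_le_s[of n] by (intro mult_left_mono) (auto simp: R_def S_def A_def E_def)
      also have "\<dots> = 3 / lam * (m * S + m * A) + m * E"
        by (simp add: algebra_simps add_divide_distrib)
      also have "\<dots> \<le> 3 / lam * (A * S + A * S) + M * E"
      proof (intro add_mono mult_left_mono)
        show "m * S \<le> A * S" using mA nn by (intro mult_right_mono)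
        show "m * A \<le> A * S" using mS nn by (simp add: mult.commute[of m] mult_left_mono)
        show "m * E \<le> M * E" using bd nn mS by (auto intro!: mult_right_mono)
      qed (use lam_pos in auto)
      finally show "m * R \<le> 6 / lam * (A * S) + M * E" by simp
    qed auto
    also have "\<dots> = R\<^sup>2 + (4 + 24 / lam) * (A * S) + 20 * M * E" by (simp add: algebra_simps)
    also have "\<dots> \<le> R\<^sup>2 + C * (A * S) + C * E"
      using nn lam_pos M(1) by (intro add_mono mult_right_mono) (auto simp: C_def)
    finally show ?thesis by (simp add: R_def A_def S_def E_def algebra_simps)
  qed
  moreover have "0 \<le> C" using lam_pos M(1) by (simp add: C_def)
  ultimately show thesis using that by blast
qed

text \<open>Nonexpansiveness between \<open>z\<^bsub>k\<^esub>\<close> and the extrapolated point \<open>\<mu>\<^sub>k\<close> prevents the residual from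
  pointing too far in the direction of the last increment.\<close>

lemma residual_inner:
  "inner (T (z (Suc n)) - z (Suc n)) (z (Suc n) - z n)
    \<le> alpha * (s n)\<^sup>2 + s n * (s (Suc n) / lam + norm (e (Suc n)))"
proof -
  define k where "k = Suc n"
  define D where "D = z k - z n"
  define D' where "D' = z (Suc k) - z k"
  define v where "v = T (z k) - z k"
  define q where "q = 1 / l k"
  have q1: "1 \<le> q" using l_pos[of k] l_less[of k] by (simp add: q_def)
  have qlam: "q \<le> 1 / lam" using l_ge[of k] lam_pos by (simp add: q_def frac_le)
  have h: "g k + e k = q *\<^sub>R (D' - a k *\<^sub>R D)"
    using increment[of n] l_pos[of k] by (simp add: k_def D_def D'_def q_def)
  \<comment> \<open>The vector \<open>x\<close> is \<open>T (z k) - T (mu k)\<close> in terms of the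
    increments. In the pairing with \<open>D\<close>, the term with \<open>a k * (q - 1)\<close> has
    a favourable sign because \<open>q \<ge> 1\<close>.\<close>
  define x where "x = v + e k + (a k * (q - 1)) *\<^sub>R D - q *\<^sub>R D'"
  have "T (z k) - T (mu k) = x"
  proof -
    have "T (mu k) = (g k + e k) - e k + (z k + a k *\<^sub>R D)"
      by (simp add: g_def mu_Suc k_def D_def)
    then show ?thesis unfolding h x_def v_def by (simp add: algebra_simps)
  qed
  then have "norm x \<le> a k * norm D"
    using T_le[of "z k" "mu k"] norm_mu_diff[of n] by (simp add: norm_minus_commute k_def D_def s_def)
  then have "norm x * norm D \<le> a k * norm D * norm D" by (intro mult_right_mono) auto
  moreover have "inner x D \<le> norm x * norm D" by (rule norm_cauchy_schwarz)
  moreover have "a k * norm D * norm D \<le> alpha * (norm D)\<^sup>2"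
    using a_le[of k] by (simp add: power2_eq_square mult.assoc mult_right_mono)
  moreover have "inner v D = inner x D - inner (e k) D - a k * (q - 1) * (norm D)\<^sup>2 + q * inner D' D"
    unfolding x_def power2_norm_eq_inner by (simp add: inner_simps)
  moreover have "0 \<le> a k * (q - 1) * (norm D)\<^sup>2" using q1 a_nonneg[of k] by simp
  moreover have "- inner (e k) D \<le> norm (e k) * norm D"
    using norm_cauchy_schwarz[of "- e k" D] by simp
  moreover have "q * inner D' D \<le> 1 / lam * (norm D' * norm D)"
    using qlam q1 by (intro order_trans[OF mult_left_mono[OF norm_cauchy_schwarz] mult_right_mono]) auto
  ultimately have "inner v D \<le> alpha * (norm D)\<^sup>2 + norm (e k) * norm D + 1 / lam * (norm D' * norm D)"
    by linarith
  then show ?thesis by (simp add: v_def D_def D'_def k_def s_def algebra_simps)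
qed

text \<open>Nonexpansiveness between \<open>mu k\<close> and \<open>z (Suc k)\<close> places
  \<open>v + e k\<close> in the ball with centre \<open>(1 - x) *\<^sub>R h\<close> and radius
  \<open>x * H\<close>. This ball lies in the ball of radius \<open>H\<close> about 0, whence the
  first claim. A gain over \<open>H\<^sup>2\<close> needs \<open>v\<close> not to be aligned with
  \<open>h\<close>, which \<open>residual_inner\<close> supplies.\<close>

lemma residual_sq_bound:
  fixes n
  defines "H \<equiv> norm (g (Suc n) + e (Suc n))" and "Q \<equiv> a (Suc n) * s n"
    and "S \<equiv> s (Suc n)" and "S' \<equiv> s (Suc (Suc n))" and "V \<equiv> r (Suc (Suc n))"
    and "E \<equiv> norm (e (Suc n))" and "E' \<equiv> norm (e (Suc (Suc n)))"
  shows "V \<le> H + E"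
    and "V\<^sup>2 \<le> (1 - (1 - theta) * (1 - alpha)) * H\<^sup>2
      + 2 / lam * (2 * (H * Q) + Q\<^sup>2 + S * S' / lam + S * E' + V * Q) + 2 * (E * H) + 2 * (V * E)"
proof -
  define k where "k = Suc n"
  define x where "x = l k"
  define h where "h = g k + e k"
  define v where "v = T (z (Suc k)) - z (Suc k)"
  define D where "D = z (Suc k) - z k"
  define D0 where "D0 = z k - z n"
  have x: "0 < x" "lam \<le> x" "x \<le> theta" "x < 1"
    using l_pos l_ge l_le l_less by (auto simp: x_def)
  have nn: "0 \<le> Q" "0 \<le> S" "0 \<le> S'" "0 \<le> V" "0 \<le> E" "0 \<le> E'" "0 \<le> H"
    using a_nonneg[of "Suc n"] s_nonneg r_nonneg
    by (auto simp: Q_def S_def S'_def V_def E_def E'_def H_def)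
  have V: "V = norm v" by (simp add: V_def r_def v_def k_def)
  have H: "H = norm h" by (simp add: H_def h_def k_def)
  have E: "E = norm (e k)" by (simp add: E_def k_def)
  have S: "S = norm D" by (simp add: S_def s_def D_def k_def)
  have D: "D = a k *\<^sub>R D0 + x *\<^sub>R h"
    using increment[of n] by (simp add: D_def D0_def x_def h_def k_def)
  have QD0: "norm (a k *\<^sub>R D0) = Q" using a_nonneg[of k] by (simp add: Q_def s_def D0_def k_def)
  have "T (z (Suc k)) - T (mu k) = (v + e k) - (1 - x) *\<^sub>R h"
    by (simp add: v_def h_def x_def g_def z_Suc algebra_simps)
  then have ball: "norm ((v + e k) - (1 - x) *\<^sub>R h) \<le> x * H"
    using T_le[of "z (Suc k)" "mu k"] x by (simp add: z_Suc' x_def h_def H)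
  have "norm (v + e k) \<le> norm ((v + e k) - (1 - x) *\<^sub>R h) + norm ((1 - x) *\<^sub>R h)"
    using norm_triangle_ineq[of "(v + e k) - (1 - x) *\<^sub>R h" "(1 - x) *\<^sub>R h"] by simp
  also have "\<dots> \<le> x * H + (1 - x) * H" using ball x by (simp add: H)
  finally have "norm (v + e k) \<le> H" by (simp add: algebra_simps)
  then show "V \<le> H + E" using norm_triangle_ineq4[of "v + e k" "e k"] by (simp add: V E)
  have "(norm ((v + e k) - (1 - x) *\<^sub>R h))\<^sup>2 \<le> (x * H)\<^sup>2" using ball by (intro power_mono) auto
  moreover have "(norm ((v + e k) - (1 - x) *\<^sub>R h))\<^sup>2
      = V\<^sup>2 + 2 * inner v (e k) + E\<^sup>2 - 2 * (1 - x) * inner v h - 2 * (1 - x) * inner (e k) h + (1 - x)\<^sup>2 * H\<^sup>2"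
    unfolding V E H power2_norm_eq_inner
    by (simp add: inner_simps inner_commute algebra_simps power2_eq_square)
  moreover have "(x * H)\<^sup>2 - (1 - x)\<^sup>2 * H\<^sup>2 = (2 * x - 1) * H\<^sup>2"
    by (simp add: power2_eq_square algebra_simps)
  ultimately have 1: "V\<^sup>2 \<le> (2 * x - 1) * H\<^sup>2 + 2 * (1 - x) * inner v h + 2 * (1 - x) * inner (e k) h
      - 2 * inner v (e k)"
    using zero_le_power2[of E] by linarith
  have ev: "- inner v (e k) \<le> V * E" using norm_cauchy_schwarz[of "- v" "e k"] by (simp add: V E)
  have "(1 - x) * inner (e k) h \<le> (1 - x) * (E * H)"
    using norm_cauchy_schwarz[of "e k" h] x by (intro mult_left_mono) (auto simp: E H)
  also have "\<dots> \<le> E * H" using x nn by (intro mult_left_le_one_le) auto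
  finally have eh: "(1 - x) * inner (e k) h \<le> E * H" .
  define Y where "Y = S * S' / lam + S * E' + V * Q"
  have Y0: "0 \<le> Y" using nn lam_pos by (simp add: Y_def)
  \<comment> \<open>Up to the inertial part, \<open>x *\<^sub>R h\<close> is the increment
    \<open>D\<close>, to which \<open>residual_inner\<close> applies.\<close>
  have "x * inner v h = inner v D - inner v (a k *\<^sub>R D0)" by (simp add: D inner_simps)
  also have "\<dots> \<le> (alpha * S\<^sup>2 + S * (S' / lam + E')) + V * Q"
  proof -
    have "inner v D \<le> alpha * S\<^sup>2 + S * (S' / lam + E')"
      using residual_inner[of k] by (simp add: v_def D_def S_def S'_def E'_def k_def)
    moreover have "- inner v (a k *\<^sub>R D0) \<le> V * Q"
      using norm_cauchy_schwarz[of "- v" "a k *\<^sub>R D0"] by (simp only: QD0 V norm_minus_cancel inner_minus_left)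
    ultimately show ?thesis by linarith
  qed
  also have "\<dots> = alpha * S\<^sup>2 + Y" by (simp add: Y_def algebra_simps)
  also have "\<dots> \<le> alpha * (x\<^sup>2 * H\<^sup>2 + 2 * x * (H * Q) + Q\<^sup>2) + Y"
  proof -
    have "S \<le> Q + x * H" unfolding S D using norm_triangle_ineq[of "a k *\<^sub>R D0" "x *\<^sub>R h"] QD0 x by (simp add: H)
    then have "S\<^sup>2 \<le> (Q + x * H)\<^sup>2" using nn by (intro power_mono)
    also have "\<dots> = x\<^sup>2 * H\<^sup>2 + 2 * x * (H * Q) + Q\<^sup>2" by (simp add: power2_eq_square algebra_simps)
    finally show ?thesis using alpha_nonneg by (simp add: mult_left_mono)
  qed
  finally have "2 * (1 - x) / x * (x * inner v h)
      \<le> 2 * (1 - x) / x * (alpha * (x\<^sup>2 * H\<^sup>2 + 2 * x * (H * Q) + Q\<^sup>2) + Y)"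
    using x by (intro mult_left_mono) auto
  also have "\<dots> = 2 * (1 - x) * alpha * x * H\<^sup>2 + 2 * (1 - x) / x * (alpha * (2 * x * (H * Q) + Q\<^sup>2) + Y)"
    using x by (simp add: field_simps power2_eq_square)
  also have "\<dots> \<le> 2 * (1 - x) * alpha * x * H\<^sup>2 + 2 / lam * (2 * (H * Q) + Q\<^sup>2 + Y)"
  proof (intro add_left_mono mult_mono)
    show "2 * (1 - x) / x \<le> 2 / lam" using x lam_pos by (intro frac_le) auto
    have "alpha * (2 * x * (H * Q) + Q\<^sup>2) \<le> 1 * (2 * 1 * (H * Q) + Q\<^sup>2)"
      using alpha_nonneg alpha_less x nn by (intro mult_mono add_mono) auto
    then show "alpha * (2 * x * (H * Q) + Q\<^sup>2) + Y \<le> 2 * (H * Q) + Q\<^sup>2 + Y" by simp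
    show "0 \<le> alpha * (2 * x * (H * Q) + Q\<^sup>2) + Y" using alpha_nonneg x nn Y0 by simp
  qed (use lam_pos in auto)
  finally have 2: "2 * (1 - x) * inner v h \<le> 2 * (1 - x) * alpha * x * H\<^sup>2 + 2 / lam * (2 * (H * Q) + Q\<^sup>2 + Y)"
    using x by simp
  \<comment> \<open>The total coefficient of \<open>H\<^sup>2\<close> equals
    \<open>1 - 2 * (1 - x) * (1 - x * alpha)\<close>.\<close>
  have "(1 - theta) * (1 - alpha) \<le> (1 - x) * (1 - x * alpha)"
    using x alpha_nonneg alpha_less theta_less by (intro mult_mono) (auto simp: mult_left_le_one_le)
  moreover have "0 \<le> (1 - x) * (1 - x * alpha)"
    using x alpha_nonneg alpha_less by (auto simp: mult_le_one)
  ultimately have "2 * x - 1 + 2 * (1 - x) * alpha * x \<le> 1 - (1 - theta) * (1 - alpha)"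
    by (simp add: algebra_simps)
  then have "(2 * x - 1 + 2 * (1 - x) * alpha * x) * H\<^sup>2 \<le> (1 - (1 - theta) * (1 - alpha)) * H\<^sup>2"
    by (intro mult_right_mono) auto
  then have 3: "(2 * x - 1) * H\<^sup>2 + 2 * (1 - x) * alpha * x * H\<^sup>2 \<le> (1 - (1 - theta) * (1 - alpha)) * H\<^sup>2"
    by (simp only: distrib_right)
  have "2 * (H * Q) + Q\<^sup>2 + S * S' / lam + S * E' + V * Q = 2 * (H * Q) + Q\<^sup>2 + Y" by (simp add: Y_def)
  then show "V\<^sup>2 \<le> (1 - (1 - theta) * (1 - alpha)) * H\<^sup>2
      + 2 / lam * (2 * (H * Q) + Q\<^sup>2 + S * S' / lam + S * E' + V * Q) + 2 * (E * H) + 2 * (V * E)"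
    using 1 2 3 ev eh by (simp only:)
qed

text \<open>In \<open>residual_sq_bound\<close>, \<open>H\<close> is replaced by
  \<open>R + 2 * Q + E\<close>. Products of \<open>Q\<close> with residuals reduce to
  \<open>Q\<^sup>2\<close> and \<open>Q * S\<close> by \<open>r_le_s\<close>, and error products are
  handled by boundedness.\<close>

lemma residual_contraction:
  obtains C where "0 \<le> C"
    "\<And>n. (1 - theta) * (1 - alpha) * (r (Suc n))\<^sup>2 \<le> (r (Suc n))\<^sup>2 - (r (Suc (Suc n)))\<^sup>2
      + C * ((a (Suc n) * s n)\<^sup>2 + a (Suc n) * s n * s (Suc n) + s (Suc n) * s (Suc (Suc n))
        + norm (e (Suc n)) + norm (e (Suc (Suc n))))"
proof -
  obtain M where M: "1 \<le> M" "\<And>n. s n \<le> M" "\<And>n. r n \<le> M" "\<And>n. norm (e n) \<le> M"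
    by (rule ex_bound) blast
  define c where "c = (1 - theta) * (1 - alpha)"
  have c: "0 < c" using theta_less alpha_less by (simp add: c_def)
  have c1: "c \<le> 1" using l_pos[of 0] l_le[of 0] theta_less alpha_less alpha_nonneg
    unfolding c_def by (intro mult_le_one) auto
  \<comment> \<open>\<open>K\<close> dominates the factor \<open>3 / lam\<close> of
    \<open>r_le_s\<close>, the bound \<open>8 * M\<close> for all quantities multiplying an error,
    and the numeral 8.\<close>
  define K where "K = 3 / lam + 8 * M"
  have "0 \<le> 3 / lam" using lam_pos by simp
  then have K: "3 / lam \<le> K" "8 * M \<le> K" "8 \<le> K" using M(1) unfolding K_def by linarith+
  \<comment> \<open>Here 19 is 15 from expanding \<open>H\<^sup>2\<close> plus 4 from the two error
    products. The 9 collects \<open>2 * (H * Q)\<close>, \<open>Q\<^sup>2\<close>,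
    \<open>S * E'\<close> and \<open>V * Q\<close>.\<close>
  define C where "C = 19 * K + 2 / lam * (9 * K + K / lam)"
  have "c * (r (Suc n))\<^sup>2 \<le> (r (Suc n))\<^sup>2 - (r (Suc (Suc n)))\<^sup>2
      + C * ((a (Suc n) * s n)\<^sup>2 + a (Suc n) * s n * s (Suc n) + s (Suc n) * s (Suc (Suc n))
        + norm (e (Suc n)) + norm (e (Suc (Suc n))))" for n
  proof -
    define H where "H = norm (g (Suc n) + e (Suc n))"
    define Q where "Q = a (Suc n) * s n"
    define S where "S = s (Suc n)"
    define S' where "S' = s (Suc (Suc n))"
    define V where "V = r (Suc (Suc n))"
    define E where "E = norm (e (Suc n))"
    define E' where "E' = norm (e (Suc (Suc n)))"
    define R where "R = r (Suc n)"
    define Y where "Y = Q\<^sup>2 + Q * S + S * S' + E + E'"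
    note defs = H_def Q_def S_def S'_def V_def E_def E'_def R_def
    have nn: "0 \<le> Q" "0 \<le> S" "0 \<le> S'" "0 \<le> V" "0 \<le> E" "0 \<le> E'" "0 \<le> H" "0 \<le> R"
      using a_nonneg[of "Suc n"] s_nonneg r_nonneg by (auto simp: defs)
    have bd: "Q \<le> M" "S \<le> M" "V \<le> M" "E \<le> M" "R \<le> M"
    proof -
      have "Q \<le> s n" unfolding Q_def using a_less[of "Suc n"] a_nonneg[of "Suc n"] s_nonneg[of n]
        by (simp add: mult_left_le_one_le)
      then show "Q \<le> M" using M(2)[of n] by simp
    qed (use M in \<open>auto simp: defs\<close>)
    have VH: "V \<le> H + E" using residual_sq_bound(1)[of n] by (simp add: defs)
    have HR: "H \<le> R + 2 * Q + E"
      using norm_triangle_ineq[of "g (Suc n)" "e (Suc n)"] g_le[of n] by (simp add: defs)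
    have RS: "R \<le> 3 / lam * (S + Q) + E" using r_le_s[of n] by (simp add: defs)
    have Y: "Q\<^sup>2 \<le> Y" "Q * S \<le> Y" "S * S' \<le> Y" "E \<le> Y" "E' \<le> Y" "0 \<le> Y" "Q\<^sup>2 + Q * S + E \<le> Y"
      using nn mult_nonneg_nonneg[of Q S] mult_nonneg_nonneg[of S S'] by (auto simp: Y_def)
    have KY: "0 \<le> K * Y" using K Y by simp
    have mono: "t \<le> K * Y" if "t \<le> 8 * M * u" "u \<le> Y" "0 \<le> u" for t u
    proof -
      have "8 * M * u \<le> K * Y" using that K M(1) by (intro mult_mono) auto
      then show ?thesis using that by simp
    qed
    have small: "t * E \<le> K * Y" if "t \<le> 8 * M" "0 \<le> t" for t
      using that nn Y by (intro mono[of _ E] mult_right_mono) auto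
    have H8: "H \<le> 8 * M" using HR bd M(1) by simp
    have EE: "E * E \<le> K * Y" and RE: "R * E \<le> K * Y" and QE: "Q * E \<le> K * Y"
      and HE: "H * E \<le> K * Y" and VE: "V * E \<le> K * Y"
      using bd nn M(1) H8 by (auto intro!: small)
    have Q2: "Q\<^sup>2 \<le> K * Y" and SS: "S * S' \<le> K * Y"
      using Y nn K M(1) by (auto intro!: order_trans[OF _ mult_right_mono[of 1 K Y]])
    have SE: "S * E' \<le> K * Y"
    proof (rule mono[of _ E'])
      show "S * E' \<le> 8 * M * E'" using bd nn M(1) by (intro mult_right_mono) auto
    qed (use Y nn in auto)
    have Qcomb: "Q * R + 2 * Q\<^sup>2 + Q * E \<le> 2 * (K * Y)"
    proof -
      have "Q * R \<le> Q * (3 / lam * (S + Q) + E)" using RS nn by (intro mult_left_mono)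
      also have "\<dots> = 3 / lam * (Q\<^sup>2 + Q * S) + Q * E"
        by (simp add: power2_eq_square algebra_simps add_divide_distrib)
      also have "\<dots> \<le> K * (Q\<^sup>2 + Q * S) + M * E"
        using K nn bd by (intro add_mono mult_right_mono) auto
      finally have "Q * R + 2 * Q\<^sup>2 + Q * E \<le> K * (Q\<^sup>2 + Q * S) + 2 * Q\<^sup>2 + 2 * (M * E)"
        using mult_right_mono[OF bd(1) nn(5)] by simp
      moreover have "2 * Q\<^sup>2 \<le> K * Q\<^sup>2" using K by (intro mult_right_mono) auto
      moreover have "M * E \<le> K * E" using K nn M(1) by (intro mult_right_mono) auto
      moreover have "0 \<le> K * (Q * S)" using K nn by simp
      moreover have "K * (Q\<^sup>2 + Q * S + E) \<le> K * Y" using Y K by (intro mult_left_mono) auto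
      ultimately show ?thesis by (simp add: algebra_simps)
    qed
    have "H\<^sup>2 \<le> (R + 2 * Q + E)\<^sup>2" using HR nn by (intro power_mono)
    also have "\<dots> = R\<^sup>2 + 4 * (Q * R + 2 * Q\<^sup>2 + Q * E) - 4 * Q\<^sup>2 + E * E + 2 * (R * E)"
      by (simp add: power2_eq_square algebra_simps)
    also have "\<dots> \<le> R\<^sup>2 + 15 * (K * Y)"
    proof -
      have "f + 4 * x - 4 * y + t + 2 * u \<le> f + 15 * d"
        if "x \<le> 2 * d" "t \<le> d" "u \<le> d" "0 \<le> y" "0 \<le> d" for f x y t u d :: real
        using that by linarith
      from this[OF Qcomb EE RE zero_le_power2 KY] show ?thesis .
    qed
    finally have "(1 - c) * H\<^sup>2 \<le> (1 - c) * (R\<^sup>2 + 15 * (K * Y))" using c1 by (intro mult_left_mono) auto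
    also have "\<dots> \<le> (1 - c) * R\<^sup>2 + 15 * (K * Y)"
      using c KY mult_nonneg_nonneg[of c "15 * (K * Y)"] by (simp add: algebra_simps)
    finally have 1: "(1 - c) * H\<^sup>2 \<le> (1 - c) * R\<^sup>2 + 15 * (K * Y)" .
    have HQ: "H * Q \<le> 2 * (K * Y)"
    proof -
      have "H * Q \<le> (R + 2 * Q + E) * Q" using HR nn by (intro mult_right_mono)
      then show ?thesis using Qcomb by (simp add: power2_eq_square algebra_simps)
    qed
    have VQ: "V * Q \<le> 3 * (K * Y)"
    proof -
      have "V * Q \<le> (H + E) * Q" using VH nn by (intro mult_right_mono)
      then show ?thesis using HQ QE by (simp add: algebra_simps)
    qed
    have "2 / lam * (2 * (H * Q) + Q\<^sup>2 + S * S' / lam + S * E' + V * Q)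
        \<le> 2 / lam * (9 * (K * Y) + K * Y / lam)"
    proof (intro mult_left_mono)
      have "S * S' / lam \<le> K * Y / lam" using SS lam_pos by (intro divide_right_mono) auto
      then show "2 * (H * Q) + Q\<^sup>2 + S * S' / lam + S * E' + V * Q \<le> 9 * (K * Y) + K * Y / lam"
        using HQ Q2 SE VQ by linarith
    qed (use lam_pos in auto)
    moreover have "V\<^sup>2 \<le> (1 - c) * H\<^sup>2
        + 2 / lam * (2 * (H * Q) + Q\<^sup>2 + S * S' / lam + S * E' + V * Q) + 2 * (E * H) + 2 * (V * E)"
      using residual_sq_bound(2)[of n] unfolding defs c_def .
    ultimately have "V\<^sup>2 \<le> (1 - c) * R\<^sup>2 + 15 * (K * Y) + 2 / lam * (9 * (K * Y) + K * Y / lam) + 4 * (K * Y)"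
      using 1 HE VE by (simp add: mult.commute[of E H])
    also have "\<dots> = (1 - c) * R\<^sup>2 + C * Y" by (simp add: C_def algebra_simps)
    finally have "c * R\<^sup>2 \<le> R\<^sup>2 - V\<^sup>2 + C * Y" by (simp add: algebra_simps)
    then show ?thesis by (simp add: Y_def defs)
  qed
  moreover have "0 \<le> C" using K lam_pos by (simp add: C_def)
  ultimately show thesis using that unfolding c_def by blast
qed

section \<open>Case 1: passing from the hypothesis to the shifted inertial series\<close>

lemma summable_inertia_of_shifted:
  assumes "summable (\<lambda>n. a n * (s n)\<^sup>2)"
  shows "summable (\<lambda>n. a (Suc n) * (s n)\<^sup>2)"
proof -
  obtain M where M: "1 \<le> M" "\<And>n. s n \<le> M" "\<And>n. r n \<le> M" "\<And>n. norm (e n) \<le> M"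
    by (rule ex_bound) blast
  obtain C1 where C1: "0 \<le> C1"
    "\<And>n. (r (Suc (Suc n)))\<^sup>2 \<le> (r (Suc n))\<^sup>2 + C1 * (a (Suc n) * s n * s (Suc n) + norm (e (Suc n)))"
    by (rule residual_growth) blast
  obtain C2 where C2: "0 \<le> C2"
    "\<And>n. (1 - theta) * (1 - alpha) * (r (Suc n))\<^sup>2 \<le> (r (Suc n))\<^sup>2 - (r (Suc (Suc n)))\<^sup>2
      + C2 * ((a (Suc n) * s n)\<^sup>2 + a (Suc n) * s n * s (Suc n) + s (Suc n) * s (Suc (Suc n))
        + norm (e (Suc n)) + norm (e (Suc (Suc n))))"
    by (rule residual_contraction) blast
  define c where "c = (1 - theta) * (1 - alpha)"
  have c: "0 < c" using theta_less alpha_less by (simp add: c_def)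
  have c1: "c \<le> 1" using l_pos[of 0] l_le[of 0] theta_less alpha_less alpha_nonneg
    unfolding c_def by (intro mult_le_one) auto
  \<comment> \<open>\<open>C3\<close> dominates every coefficient that arises for
    \<open>b < q\<close>. The number \<open>q\<close> is both the threshold for \<open>b\<close> and
    the weight in \<open>amgm\<close>; \<open>C3 * q = c / 8\<close> keeps the absorbed terms small
    against \<open>c\<close>.\<close>
  define C3 where "C3 = 3 * C1 + 3 * C2 + 27 + 3 * M"
  have C3: "3 * C1 \<le> C3" "27 \<le> C3" using C1 C2 M(1) by (auto simp: C3_def)
  define q where "q = c / (8 * C3)"
  have q: "0 < q" using c C3 by (simp add: q_def)
  have qC: "C3 * q = c / 8" using C3 by (simp add: q_def)
  define w where "w n = (C3 + 1) / q * (a (Suc (Suc n)) * (s (Suc (Suc n)))\<^sup>2 + a (Suc n) * (s (Suc n))\<^sup>2)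
    + C3 * (norm (e (Suc n)) + norm (e (Suc (Suc n))))" for n
  have w0: "0 \<le> w n" for n using C3 q a_nonneg by (simp add: w_def)
  have sw: "summable w"
  proof -
    have e1: "summable (\<lambda>n. norm (e (Suc n)))"
      using summable_e summable_Suc_iff[of "\<lambda>n. norm (e n)"] by simp
    then have e2: "summable (\<lambda>n. norm (e (Suc (Suc n))))"
      using summable_Suc_iff[of "\<lambda>n. norm (e (Suc n))"] by simp
    have b1: "summable (\<lambda>n. a (Suc n) * (s (Suc n))\<^sup>2)"
      using assms summable_Suc_iff[of "\<lambda>n. a n * (s n)\<^sup>2"] by simp
    then have b2: "summable (\<lambda>n. a (Suc (Suc n)) * (s (Suc (Suc n)))\<^sup>2)"
      using summable_Suc_iff[of "\<lambda>n. a (Suc n) * (s (Suc n))\<^sup>2"] by simp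
    show ?thesis unfolding w_def by (intro summable_add summable_mult e1 e2 b1 b2)
  qed
  have amgm: "x * y * t \<le> q * (x * y\<^sup>2) + 1 / (4 * q) * (x * t\<^sup>2)" if "0 \<le> x" for x y t :: real
  proof -
    have "0 \<le> x * (q * (y - t / (2 * q))\<^sup>2)" using that q by simp
    also have "\<dots> = q * (x * y\<^sup>2) + 1 / (4 * q) * (x * t\<^sup>2) - x * y * t"
      using q by (simp add: power2_eq_square field_simps)
    finally show ?thesis by simp
  qed
  \<comment> \<open>The second summand pays for the predecessor term
    \<open>c / 4 * (b * S0\<^sup>2)\<close> in \<open>main\<close>. The descent closes because
    \<open>c / 4 + c / 4 + c / 8 \<le> c\<close>.\<close>
  define P where "P n = 3 * (r (Suc n))\<^sup>2 + c / 4 * (a (Suc n) * (s n)\<^sup>2)" for n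
  have step: "P (Suc n) + c / 4 * (a (Suc (Suc n)) * (s (Suc n))\<^sup>2) \<le> P n + w n" for n
  proof -
    define b where "b = a (Suc n)"
    define b' where "b' = a (Suc (Suc n))"
    define S0 where "S0 = s n"
    define S where "S = s (Suc n)"
    define S' where "S' = s (Suc (Suc n))"
    define V where "V = r (Suc (Suc n))"
    define E where "E = norm (e (Suc n))"
    define E' where "E' = norm (e (Suc (Suc n)))"
    define R where "R = r (Suc n)"
    define Q where "Q = b * S0"
    note defs = b_def b'_def S0_def S_def S'_def V_def E_def E'_def R_def Q_def
    have nn: "0 \<le> b" "0 \<le> b'" "0 \<le> S0" "0 \<le> S" "0 \<le> S'" "0 \<le> V" "0 \<le> E" "0 \<le> E'" "0 \<le> R" "0 \<le> Q"
      using a_nonneg s_nonneg r_nonneg by (auto simp: defs)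
    have b1: "b \<le> 1" "b' \<le> 1" using a_less[of "Suc n"] a_less[of "Suc (Suc n)"] by (auto simp: defs)
    have growth: "V\<^sup>2 \<le> R\<^sup>2 + C1 * (Q * S + E)" using C1(2)[of n] by (simp add: defs)
    have QS: "Q * S \<le> q * (b * S0\<^sup>2) + 1 / (4 * q) * (b * S\<^sup>2)"
      unfolding Q_def by (rule amgm) (rule nn)
    have SS: "b' * S * S' \<le> q * (b' * S\<^sup>2) + 1 / (4 * q) * (b' * S'\<^sup>2)"
      by (rule amgm) (rule nn)
    have nn': "0 \<le> b * S0\<^sup>2" "0 \<le> b * S\<^sup>2" "0 \<le> b' * S\<^sup>2" "0 \<le> b' * S'\<^sup>2" "0 \<le> Q * S" using nn by auto
    have main: "c * (b' * S\<^sup>2) \<le> 3 * (R\<^sup>2 - V\<^sup>2) + c / 4 * (b * S0\<^sup>2) + c / 8 * (b' * S\<^sup>2)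
        + ((C3 + 1) / q * (b' * S'\<^sup>2 + b * S\<^sup>2) + C3 * (E + E'))"
    \<comment> \<open>for small \<open>b\<close> the term \<open>(b S0)\<^sup>2\<close> can be absorbed; otherwise the hypothesis bounds \<open>S\<^sup>2\<close>\<close>
    proof (cases "b < q")
      case True
      have "S \<le> R + 3 * Q + E" using s_le[of n] by (simp add: defs)
      then have "S\<^sup>2 \<le> (R + 3 * Q + E)\<^sup>2" using nn by (intro power_mono)
      also have "\<dots> \<le> 3 * R\<^sup>2 + 27 * Q\<^sup>2 + 3 * E\<^sup>2"
        using zero_le_power2[of "R - 3 * Q"] zero_le_power2[of "R - E"] zero_le_power2[of "3 * Q - E"]
        by (simp add: power2_eq_square algebra_simps)
      also have "E\<^sup>2 \<le> M * E"
        using M(4)[of "Suc n"] nn by (simp add: power2_eq_square E_def mult_right_mono)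
      finally have "S\<^sup>2 \<le> 3 * R\<^sup>2 + (27 * Q\<^sup>2 + 3 * M * E)" by simp
      then have "c * b' * S\<^sup>2 \<le> c * b' * (3 * R\<^sup>2 + (27 * Q\<^sup>2 + 3 * M * E))"
        using c nn by (intro mult_left_mono) auto
      also have "\<dots> = 3 * (b' * (c * R\<^sup>2)) + c * b' * (27 * Q\<^sup>2 + 3 * M * E)" by (simp add: algebra_simps)
      also have "\<dots> \<le> 3 * (b' * (R\<^sup>2 - V\<^sup>2 + C2 * (Q\<^sup>2 + Q * S + S * S' + E + E'))) + (27 * Q\<^sup>2 + 3 * M * E)"
      proof (intro add_mono mult_left_mono)
        show "c * R\<^sup>2 \<le> R\<^sup>2 - V\<^sup>2 + C2 * (Q\<^sup>2 + Q * S + S * S' + E + E')"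
          using C2(2)[of n] by (simp add: c_def defs)
        have "c * b' \<le> 1" using c1 b1 nn by (intro mult_le_one)
        then show "c * b' * (27 * Q\<^sup>2 + 3 * M * E) \<le> 27 * Q\<^sup>2 + 3 * M * E"
          using c nn M(1) by (intro mult_left_le_one_le) auto
      qed (use nn in auto)
      also have "\<dots> = 3 * (b' * (R\<^sup>2 - V\<^sup>2)) + 3 * C2 * (b' * (Q\<^sup>2 + Q * S + E + E') + b' * S * S')
          + (27 * Q\<^sup>2 + 3 * M * E)" by (simp add: algebra_simps)
      also have "\<dots> \<le> 3 * ((R\<^sup>2 - V\<^sup>2) + C1 * (Q * S + E)) + 3 * C2 * ((Q\<^sup>2 + Q * S + E + E') + b' * S * S')
          + (27 * Q\<^sup>2 + 3 * M * E)"
      proof (rule add_right_mono, intro add_mono[OF mult_left_mono mult_left_mono[OF add_right_mono]])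
        have "(1 - b') * (V\<^sup>2 - R\<^sup>2) \<le> (1 - b') * (C1 * (Q * S + E))"
          using growth b1 by (intro mult_left_mono) auto
        also have "\<dots> \<le> C1 * (Q * S + E)"
          using b1 nn C1(1) by (intro mult_left_le_one_le) auto
        finally show "b' * (R\<^sup>2 - V\<^sup>2) \<le> (R\<^sup>2 - V\<^sup>2) + C1 * (Q * S + E)" by (simp add: algebra_simps)
        show "b' * (Q\<^sup>2 + Q * S + E + E') \<le> Q\<^sup>2 + Q * S + E + E'"
          using b1 nn by (intro mult_left_le_one_le) auto
      qed (use C2 in auto)
      also have "\<dots> = 3 * (R\<^sup>2 - V\<^sup>2) + (3 * C2 + 27) * Q\<^sup>2 + (3 * C1 + 3 * C2) * (Q * S)
          + 3 * C2 * (b' * S * S') + (3 * C1 + 3 * C2 + 3 * M) * E + 3 * C2 * E'"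
        by (simp add: algebra_simps)
      also have "\<dots> \<le> 3 * (R\<^sup>2 - V\<^sup>2) + C3 * (q * (b * S0\<^sup>2)) + C3 * (q * (b * S0\<^sup>2) + 1 / (4 * q) * (b * S\<^sup>2))
          + C3 * (q * (b' * S\<^sup>2) + 1 / (4 * q) * (b' * S'\<^sup>2)) + C3 * E + C3 * E'"
      proof (intro add_mono[OF add_mono[OF add_mono[OF add_mono[OF add_mono[OF order_refl]]]]] mult_mono QS SS)
        have "Q\<^sup>2 = b * (b * S0\<^sup>2)" by (simp add: Q_def power2_eq_square)
        also have "\<dots> \<le> q * (b * S0\<^sup>2)" using True nn' by (intro mult_right_mono) auto
        finally show "Q\<^sup>2 \<le> q * (b * S0\<^sup>2)" .
      qed (use C1(1) C2(1) M(1) nn in \<open>auto simp: C3_def\<close>)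
      also have "\<dots> = 3 * (R\<^sup>2 - V\<^sup>2) + 2 * (C3 * q) * (b * S0\<^sup>2) + C3 * q * (b' * S\<^sup>2)
          + (C3 / (4 * q) * (b' * S'\<^sup>2 + b * S\<^sup>2) + C3 * (E + E'))"
        by (simp add: algebra_simps)
      also have "\<dots> = 3 * (R\<^sup>2 - V\<^sup>2) + c / 4 * (b * S0\<^sup>2) + c / 8 * (b' * S\<^sup>2)
          + (C3 / (4 * q) * (b' * S'\<^sup>2 + b * S\<^sup>2) + C3 * (E + E'))"
        by (simp add: qC)
      also have "C3 / (4 * q) * (b' * S'\<^sup>2 + b * S\<^sup>2) \<le> (C3 + 1) / q * (b' * S'\<^sup>2 + b * S\<^sup>2)"
        using q C3 nn' by (intro mult_right_mono frac_le) auto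
      finally show ?thesis by (simp add: mult.assoc)
    next
      case False
      have "q * (c * (b' * S\<^sup>2)) \<le> b * (1 * (1 * S\<^sup>2))"
        using False q c c1 b1 nn by (intro mult_mono) auto
      then have "c * (b' * S\<^sup>2) \<le> 1 / q * (b * S\<^sup>2)" using q by (simp add: pos_le_divide_eq mult.commute)
      \<comment> \<open>The telescoping difference \<open>3 * (R\<^sup>2 - V\<^sup>2)\<close> may be
        negative here; this estimate together with \<open>growth\<close> bounds it from
        below.\<close>
      moreover have "3 * C1 * (Q * S + E) \<le> C3 * (q * (b * S0\<^sup>2) + 1 / (4 * q) * (b * S\<^sup>2) + E)"
        using C3 C1(1) nn' nn QS by (intro mult_mono add_mono) auto
      then have "3 * C1 * (Q * S + E) \<le> C3 * q * (b * S0\<^sup>2) + C3 / (4 * q) * (b * S\<^sup>2) + C3 * E"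
        by (simp add: algebra_simps)
      then have "3 * C1 * (Q * S + E) \<le> c / 8 * (b * S0\<^sup>2) + C3 / (4 * q) * (b * S\<^sup>2) + C3 * E"
        unfolding qC .
      moreover have "C3 / (4 * q) * (b * S\<^sup>2) \<le> C3 / q * (b * S\<^sup>2)"
        using q C3 nn' by (intro mult_right_mono frac_le) auto
      moreover have "(C3 + 1) / q * (b' * S'\<^sup>2 + b * S\<^sup>2) = (C3 + 1) / q * (b' * S'\<^sup>2) + C3 / q * (b * S\<^sup>2) + 1 / q * (b * S\<^sup>2)"
        using q by (simp add: field_simps)
      moreover have "0 \<le> (C3 + 1) / q * (b' * S'\<^sup>2)" "0 \<le> c * (b * S0\<^sup>2)" "0 \<le> c * (b' * S\<^sup>2)" "0 \<le> C3 * E'"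
        using q C3 nn' nn c by auto
      moreover have "3 * V\<^sup>2 \<le> 3 * R\<^sup>2 + 3 * C1 * (Q * S + E)" using growth by simp
      ultimately show ?thesis by (simp add: distrib_left right_diff_distrib)
    qed
    have "0 \<le> c * (b' * S\<^sup>2)" using c nn' by simp
    then show ?thesis using main by (simp add: P_def w_def defs)
  qed
  have "summable (\<lambda>n. c / 4 * (a (Suc (Suc n)) * (s (Suc n))\<^sup>2))"
  proof (rule summable_of_descent[where P = P and w = w and B = 0])
    show "0 \<le> P n" for n using c a_nonneg[of "Suc n"] by (simp add: P_def)
  qed (use c a_nonneg w0 sw step in auto)
  then have "summable (\<lambda>n. a (Suc (Suc n)) * (s (Suc n))\<^sup>2)"
    using c summable_cmult_iff[of "c / 4" "\<lambda>n. a (Suc (Suc n)) * (s (Suc n))\<^sup>2"] by simp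
  then show ?thesis using summable_Suc_iff[of "\<lambda>n. a (Suc n) * (s n)\<^sup>2"] by simp
qed

subsection \<open>Case 2: the Lyapunov function\<close>

lemma summable_increments_of_monotone:
  fixes sigma delta :: real
  assumes mono: "\<And>n. a n \<le> a (Suc n)" and sigma: "0 < sigma" and delta: "0 < delta"
    and l: "\<And>n. l n * (delta * (1 + alpha * (1 + alpha) + alpha * delta + sigma))
      \<le> delta - alpha * (alpha * (1 + alpha) + alpha * delta + sigma)"
  shows "summable (\<lambda>n. (s n)\<^sup>2)"
proof -
  obtain M where M: "1 \<le> M" "\<And>n. s n \<le> M" "\<And>n. r n \<le> M" "\<And>n. norm (e n) \<le> M"
    by (rule ex_bound) blast
  obtain p where p: "p \<in> Fix T" using Fix_ne by blast
  obtain B0 where B0: "\<And>n. norm (z n) \<le> B0"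
    using bounded_z by (auto simp: bounded_iff)
  define B where "B = (B0 + norm p)\<^sup>2"
  define G where "G = alpha * (1 + alpha) + alpha * delta"
  define phi where "phi n = (norm (z n - p))\<^sup>2" for n
  have phiB: "phi n \<le> B" for n
    using norm_triangle_ineq4[of "z n" p] B0[of n] unfolding phi_def B_def by (intro power_mono) auto
  have phi0: "0 \<le> phi n" for n by (simp add: phi_def)
  define gam where "gam n = a n * (1 + a n) + a n * delta * (1 - l n)" for n
  have gam0: "0 \<le> gam n" for n using a_nonneg[of n] delta l_less[of n] by (simp add: gam_def)
  have gamG: "gam n \<le> G" for n
  proof -
    have "a n * (1 + a n) \<le> alpha * (1 + alpha)"
      using a_nonneg[of n] a_le[of n] by (intro mult_mono) auto
    moreover have "a n * delta * (1 - l n) \<le> alpha * delta * 1"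
      using a_nonneg[of n] a_le[of n] delta l_pos[of n] l_less[of n] alpha_nonneg by (intro mult_mono) auto
    ultimately show ?thesis by (simp add: gam_def G_def)
  qed
  define P where "P n = phi (Suc n) - a (Suc n) * phi n + gam (Suc n) * (s n)\<^sup>2" for n
  define w where "w n = 2 * norm (z (Suc n + 1) - p) * l (Suc n) * norm (e (Suc n))
    + 12 * M * norm (e (Suc n))" for n
  have step: "P (Suc n) + sigma * (s (Suc n))\<^sup>2 \<le> P n + w n" for n
  proof -
    define b where "b = a (Suc n)"
    define x where "x = l (Suc n)"
    define S where "S = s n"
    define S' where "S' = s (Suc n)"
    define h where "h = g (Suc n) + e (Suc n)"
    define D where "D = z (Suc n) - z n"
    define D' where "D' = z (Suc (Suc n)) - z (Suc n)"
    define E where "E = norm (e (Suc n))"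
    \<comment> \<open>This weight in Young's inequality makes both remaining coefficients multiples
      of \<open>x\<close>: \<open>1 - b / t = x * delta / t\<close> and
      \<open>b\<^sup>2 - b * t = - x * b * delta\<close>.\<close>
    define t where "t = b + delta * x"
    note defs = b_def x_def S_def S'_def h_def E_def
    have x: "0 < x" "x < 1" using l_pos l_less by (auto simp: x_def)
    have b: "0 \<le> b" "b \<le> alpha" using a_nonneg a_le by (auto simp: b_def)
    have t: "0 < t" using x b delta by (simp add: t_def add_nonneg_pos)
    have xh: "x *\<^sub>R h = D' - b *\<^sub>R D"
      using increment[of n] by (simp add: defs D_def D'_def)
    have SD: "S = norm D" "S' = norm D'" by (auto simp: S_def S'_def s_def D_def D'_def)
    have h4: "norm h \<le> 6 * M"
    proof -
      have "norm (g (Suc n)) \<le> M + 2 * (1 * M)"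
        using g_le[of n] M(3)[of "Suc n"] M(2)[of n]
          mult_mono[of "a (Suc n)" 1 "s n" M] a_less[of "Suc n"] s_nonneg[of n] by simp
      then show ?thesis using norm_triangle_ineq[of "g (Suc n)" "e (Suc n)"] M(4)[of "Suc n"] M(1)
        by (simp add: h_def)
    qed
    have "(norm h)\<^sup>2 \<le> (norm (g (Suc n)))\<^sup>2 + 2 * (norm h * E)"
      using norm_add_sq_le[of "g (Suc n)" "e (Suc n)"] by (simp add: h_def E_def)
    also have "norm h * E \<le> 6 * M * E" using h4 by (intro mult_right_mono) (auto simp: E_def)
    finally have "(norm h)\<^sup>2 - 12 * M * E \<le> (norm (g (Suc n)))\<^sup>2" by simp
    then have "x * (1 - x) * ((norm h)\<^sup>2 - 12 * M * E) \<le> x * (1 - x) * (norm (g (Suc n)))\<^sup>2"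
      using x by (intro mult_left_mono) auto
    moreover have "x * (1 - x) * (12 * M * E) \<le> 12 * M * E"
      using x M(1) by (intro mult_left_le_one_le mult_le_one) (auto simp: E_def)
    ultimately have gh: "x * (1 - x) * (norm h)\<^sup>2 - 12 * M * E \<le> x * (1 - x) * (norm (g (Suc n)))\<^sup>2"
      by (simp only: right_diff_distrib)
    have "x\<^sup>2 * (norm h)\<^sup>2 = (norm (D' - b *\<^sub>R D))\<^sup>2"
      using xh[symmetric] by (simp add: power_mult_distrib)
    also have "\<dots> = S'\<^sup>2 - 2 * b * inner D' D + b\<^sup>2 * S\<^sup>2"
      unfolding SD power2_norm_eq_inner
      by (simp add: inner_simps inner_commute algebra_simps power2_eq_square)
    also have "\<dots> \<ge> S'\<^sup>2 - b * (S'\<^sup>2 / t + t * S\<^sup>2) + b\<^sup>2 * S\<^sup>2"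
    proof -
      have "0 \<le> (S' - t * S)\<^sup>2 / t" using t by simp
      then have "2 * (S' * S) \<le> S'\<^sup>2 / t + t * S\<^sup>2"
        using t by (simp add: power2_eq_square field_simps)
      then have "2 * inner D' D \<le> S'\<^sup>2 / t + t * S\<^sup>2"
        using norm_cauchy_schwarz[of D' D] by (simp add: SD)
      then have "b * (2 * inner D' D) \<le> b * (S'\<^sup>2 / t + t * S\<^sup>2)" using b by (intro mult_left_mono) auto
      then show ?thesis by simp
    qed
    also have "S'\<^sup>2 - b * (S'\<^sup>2 / t + t * S\<^sup>2) + b\<^sup>2 * S\<^sup>2 = x * (delta / t * S'\<^sup>2 - b * delta * S\<^sup>2)"
    proof -
      have "S'\<^sup>2 - b * (S'\<^sup>2 / t) = x * (delta / t * S'\<^sup>2)" using t by (simp add: t_def field_simps)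
      moreover have "b\<^sup>2 * S\<^sup>2 - b * (t * S\<^sup>2) = - x * (b * delta * S\<^sup>2)"
        by (simp add: t_def power2_eq_square algebra_simps)
      ultimately show ?thesis by (simp add: algebra_simps)
    qed
    finally have "x * (delta / t * S'\<^sup>2 - b * delta * S\<^sup>2) \<le> x * (x * (norm h)\<^sup>2)"
      by (simp add: power2_eq_square mult.assoc)
    then have "delta / t * S'\<^sup>2 - b * delta * S\<^sup>2 \<le> x * (norm h)\<^sup>2"
      using x by simp
    then have "(1 - x) * (delta / t * S'\<^sup>2 - b * delta * S\<^sup>2) \<le> (1 - x) * (x * (norm h)\<^sup>2)"
      using x by (intro mult_left_mono) auto
    then have h: "(1 - x) * (delta / t) * S'\<^sup>2 - b * delta * (1 - x) * S\<^sup>2 \<le> x * (1 - x) * (norm h)\<^sup>2"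
      by (simp add: algebra_simps)
    \<comment> \<open>After multiplication by \<open>alpha + delta * x\<close>, which is at least
      \<open>t\<close>, this is the upper bound on the relaxation parameter rearranged.\<close>
    have "G + sigma \<le> (1 - x) * (delta / t)"
    proof -
      have "t * (G + sigma) \<le> (alpha + delta * x) * (G + sigma)"
        using b sigma gam0[of 0] gamG[of 0] by (intro mult_right_mono) (auto simp: t_def)
      also have "\<dots> \<le> (1 - x) * delta"
        using l[of "Suc n"] by (simp add: x_def G_def algebra_simps)
      finally show ?thesis using t by (simp add: pos_le_divide_eq mult.commute)
    qed
    then have "gam (Suc (Suc n)) + sigma \<le> (1 - x) * (delta / t)" using gamG[of "Suc (Suc n)"] by simp
    then have "(gam (Suc (Suc n)) + sigma) * S'\<^sup>2 \<le> (1 - x) * (delta / t) * S'\<^sup>2"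
      by (intro mult_right_mono) auto
    \<comment> \<open>Monotonicity of the inertial parameters makes the terms \<open>a * phi\<close>
      of consecutive values of \<open>P\<close> fit together.\<close>
    moreover have "a (Suc n) * phi (Suc n) \<le> a (Suc (Suc n)) * phi (Suc n)"
      using mono phi0 by (intro mult_right_mono)
    moreover have "phi (Suc (Suc n)) \<le> (1 + b) * phi (Suc n) - b * phi n + b * (1 + b) * S\<^sup>2
        - x * (1 - x) * (norm (g (Suc n)))\<^sup>2 + 2 * norm (z (Suc n + 1) - p) * x * E"
      using fundamental_inequality[OF p, of n] by (simp add: defs phi_def)
    moreover have "gam (Suc n) * S\<^sup>2 = b * (1 + b) * S\<^sup>2 + b * delta * (1 - x) * S\<^sup>2"
      by (simp add: gam_def defs distrib_right)
    moreover have "(1 + b) * phi (Suc n) = phi (Suc n) + b * phi (Suc n)" by (simp add: distrib_right)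
    moreover have "(gam (Suc (Suc n)) + sigma) * S'\<^sup>2 = gam (Suc (Suc n)) * S'\<^sup>2 + sigma * S'\<^sup>2"
      by (simp add: distrib_right)
    ultimately show ?thesis using gh h unfolding P_def w_def defs[symmetric] by linarith
  qed
  have "summable (\<lambda>n. sigma * (s (Suc n))\<^sup>2)"
  proof (rule summable_of_descent[where P = P and w = w and B = "- B"])
    show "0 \<le> w n" for n using l_pos[of "Suc n"] M(1) by (simp add: w_def)
    show "summable w" unfolding w_def
      using summable_e summable_Suc_iff[of "\<lambda>n. norm (e n)"]
      by (intro summable_add summable_mult summable_error_term) simp
    show "- B \<le> P n" for n
    proof -
      have "a (Suc n) * phi n \<le> 1 * B"
        using a_nonneg[of "Suc n"] a_less[of "Suc n"] phi0 phiB by (intro mult_mono) auto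
      then show ?thesis using phi0[of "Suc n"] gam0[of "Suc n"] by (simp add: P_def add_increasing2)
    qed
  qed (use sigma step in auto)
  then have "summable (\<lambda>n. (s (Suc n))\<^sup>2)"
    using sigma summable_cmult_iff[of sigma "\<lambda>n. (s (Suc n))\<^sup>2"] by simp
  then show ?thesis using summable_Suc_iff[of "\<lambda>n. (s n)\<^sup>2"] by simp
qed

end

section \<open>Reduction of both cases to the common iteration\<close>

theorem theorem3:
  fixes T :: "'a::{real_inner, complete_space} \<Rightarrow> 'a"
    and z mu e :: "nat \<Rightarrow> 'a" and zm1 :: 'a
    and alpha_seq lam_seq :: "nat \<Rightarrow> real"
    and alpha lam theta :: real
  assumes nonexp: "nonexpansive T"
    and fix_ne: "Fix T \<noteq> {}"
    and mu0: "mu 0 = z 0 + alpha_seq 0 *\<^sub>R (z 0 - zm1)"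
    and muk: "\<And>k. k \<ge> 1 \<Longrightarrow> mu k = z k + alpha_seq k *\<^sub>R (z k - z (k - 1))"
    and zk: "\<And>k. z (Suc k) = mu k + lam_seq k *\<^sub>R (T (mu k) + e k - mu k)"
    and cases:
      "(\<exists>lam'. 0 \<le> alpha \<and> alpha < 1 \<and> 0 < lam \<and> lam \<le> lam' \<and> lam' < 1
          \<and> (\<forall>k. 0 \<le> alpha_seq k \<and> alpha_seq k \<le> alpha)
          \<and> (\<forall>k. lam \<le> lam_seq k \<and> lam_seq k \<le> lam')
          \<and> summable (\<lambda>k. alpha_seq k * (norm (z (Suc k) - z k))\<^sup>2)
          \<and> summable (\<lambda>k. lam_seq k * norm (e k))
          \<and> bounded (range z)
          \<and> theta = lam')
       \<or>
       (\<exists>sigma delta. mono alpha_seq \<and> mono lam_seq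
          \<and> 0 \<le> alpha \<and> alpha < 1
          \<and> (\<forall>k. 0 \<le> alpha_seq k \<and> alpha_seq k \<le> alpha) \<and> alpha_seq 0 = 0
          \<and> lam > 0 \<and> sigma > 0 \<and> delta > 0
          \<and> delta > alpha * (alpha * (1 + alpha) + sigma) / (1 - alpha\<^sup>2)
          \<and> theta = (delta - alpha * (alpha * (1 + alpha) + alpha * delta + sigma))
                    / (delta * (1 + alpha * (1 + alpha) + alpha * delta + sigma))
          \<and> (\<forall>k. lam \<le> lam_seq k \<and> lam_seq k \<le> theta)
          \<and> bounded (range z)
          \<and> summable (\<lambda>k. norm (e k)))"
  shows "\<forall>zs \<in> Fix T.
     summable (\<lambda>k. pos_part ((norm (z (Suc k) - zs))\<^sup>2 - (norm (z k - zs))\<^sup>2))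
   \<and> summable (\<lambda>k. 2 * norm (z (Suc k + 1) - zs) * lam_seq (Suc k) * norm (e (Suc k)))
   \<and> summable (\<lambda>k. alpha_seq (Suc k) * (1 + alpha_seq (Suc k)) * (norm (z (Suc k) - z k))\<^sup>2)
   \<and> (let Delta =
          alpha * (\<Sum>k. pos_part ((norm (z (Suc k) - zs))\<^sup>2 - (norm (z k - zs))\<^sup>2))
        + (\<Sum>k. 2 * norm (z (Suc k + 1) - zs) * lam_seq (Suc k) * norm (e (Suc k)))
        + (\<Sum>k. alpha_seq (Suc k) * (1 + alpha_seq (Suc k)) * (norm (z (Suc k) - z k))\<^sup>2)
      in \<forall>k\<ge>1. Min ((\<lambda>i. (norm (T (mu i) - mu i))\<^sup>2) ` {1..k})
             \<le> 1 / (real k * lam * (1 - theta)) * ((norm (z 1 - zs))\<^sup>2 + Delta))"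
proof -
  have key: "inertial_iteration T z mu e alpha_seq lam_seq alpha lam theta
    \<and> summable (\<lambda>n. alpha_seq (Suc n) * (norm (z (Suc n) - z n))\<^sup>2)"
    using cases
  proof (elim disjE exE conjE)
    fix lam'
    assume A: "alpha < 1" "0 < lam" "lam' < 1"
      "\<forall>k. 0 \<le> alpha_seq k \<and> alpha_seq k \<le> alpha" "\<forall>k. lam \<le> lam_seq k \<and> lam_seq k \<le> lam'"
      "bounded (range z)" "theta = lam'"
      and inert: "summable (\<lambda>k. alpha_seq k * (norm (z (Suc k) - z k))\<^sup>2)"
      and err: "summable (\<lambda>k. lam_seq k * norm (e k))"
    \<comment> \<open>The weights are at least \<open>lam > 0\<close>, so the weighted error series
      controls the unweighted one.\<close>
    have "summable (\<lambda>k. norm (e k))"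
    proof (rule summable_comparison_test'[where N = 0])
      show "summable (\<lambda>k. 1 / lam * (lam_seq k * norm (e k)))" using err by (rule summable_mult)
      show "norm (norm (e k)) \<le> 1 / lam * (lam_seq k * norm (e k))" for k
        using A(2,5) by (simp add: pos_le_divide_eq mult.commute mult_right_mono)
    qed
    then interpret inertial_iteration T z mu e alpha_seq lam_seq alpha lam theta
      using nonexp fix_ne muk zk A by unfold_locales auto
    show ?thesis
      using summable_inertia_of_shifted inert inertial_iteration_axioms by (simp add: s_def)
  next
    fix sigma delta
    assume A: "alpha < 1" "0 \<le> alpha" "0 < lam"
      "\<forall>k. 0 \<le> alpha_seq k \<and> alpha_seq k \<le> alpha" "\<forall>k. lam \<le> lam_seq k \<and> lam_seq k \<le> theta"
      "bounded (range z)" "summable (\<lambda>k. norm (e k))"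
      and sd: "0 < sigma" "0 < delta"
      and theta: "theta = (delta - alpha * (alpha * (1 + alpha) + alpha * delta + sigma))
                    / (delta * (1 + alpha * (1 + alpha) + alpha * delta + sigma))"
      and "mono alpha_seq"
    define X where "X = alpha * (1 + alpha) + alpha * delta + sigma"
    have X: "0 < X" using A(2) sd by (simp add: X_def add_nonneg_pos)
    have den: "0 < delta * (1 + X)" using X sd by simp
    have theta': "theta = (delta - alpha * X) / (delta * (1 + X))"
      using theta by (simp add: X_def add.assoc)
    \<comment> \<open>The numerator of \<open>theta\<close> is at most \<open>delta\<close>, and the
      denominator exceeds \<open>delta\<close>.\<close>
    have "theta < 1"
    proof -
      have "0 < delta * X" "0 \<le> alpha * X" using A(2) X sd by auto
      then have "delta - alpha * X < 1 * (delta * (1 + X))" by (simp add: distrib_left)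
      then show ?thesis unfolding theta' using den by (simp only: pos_divide_less_eq)
    qed
    then interpret inertial_iteration T z mu e alpha_seq lam_seq alpha lam theta
      using nonexp fix_ne muk zk A by unfold_locales auto
    have "summable (\<lambda>n. (s n)\<^sup>2)"
    proof (rule summable_increments_of_monotone[OF _ sd])
      show "alpha_seq n \<le> alpha_seq (Suc n)" for n using \<open>mono alpha_seq\<close> by (simp add: mono_def)
      show "lam_seq n * (delta * (1 + alpha * (1 + alpha) + alpha * delta + sigma))
          \<le> delta - alpha * (alpha * (1 + alpha) + alpha * delta + sigma)" for n
        using l_le[of n] den unfolding theta' by (simp add: pos_le_divide_eq X_def add.assoc)
    qed
    then have "summable (\<lambda>n. alpha_seq (Suc n) * (s n)\<^sup>2)"
    proof (rule summable_comparison_test'[where N = 0])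
      show "norm (alpha_seq (Suc n) * (s n)\<^sup>2) \<le> (s n)\<^sup>2" for n
        using a_nonneg[of "Suc n"] a_less[of "Suc n"] by (simp add: mult_left_le_one_le)
    qed
    then show ?thesis using inertial_iteration_axioms by (simp add: s_def)
  qed
  then interpret inertial_iteration T z mu e alpha_seq lam_seq alpha lam theta by blast
  have sm: "summable (\<lambda>n. alpha_seq (Suc n) * (s n)\<^sup>2)" using key by (simp add: s_def)
  show ?thesis
    unfolding Let_def s_def[symmetric]
    by (intro ballI conjI allI impI summable_pos_part[OF sm] summable_error_term
        summable_inertial_term[OF sm] residual_bound[OF sm])
qed

end
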